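(* Let $p\in\mathbb{R}[x]$ with $p\neq 0$, and let $qs=[q_0,\dots,q_{n-1}]$ be a finite list (possibly empty) of polynomials in $\mathbb{R}[x]$ such that every $q$ in $qs$ is coprime to $p$. Then the set of entries of the list $\mathtt{find\_consistent\_signs\_at\_roots}(p,qs)$ produced by the recursive algorithm defined in the context is exactly the set of sign vectors of $qs$ realized at the real roots of $p$: $$\{\sigma : \sigma\in\mathtt{find\_consistent\_signs\_at\_roots}(p,qs)\}=\bigl\{(\mathrm{sgn}\,q_0(x),\dots,\mathrm{sgn}\,q_{n-1}(x)) : x\in\mathbb{R},\ p(x)=0\bigr\}.$$
   Context: $\mathrm{sgn}(y)\in\{-1,0,+1\}$ is the sign of a real $y$. A sign vector for a list of $m$ polynomials is a list of $m$ elements of $\{-1,0,1\}$. $\mathtt{find\_consistent\_signs\_at\_roots}(p,qs)$ is the third component $\Sigma$ of $\mathtt{calc\_data}(p,qs)=(M,S,\Sigma)$. Here $M$ is a rational matrix, $S$ is a list of lists of indices into $qs$ (indices start at $0$), and $\Sigma$ is a list of sign vectors. Rows of $M$ correspond to entries of $S$ and columns to entries of $\Sigma$. It is defined as follows. *Tarski query:* for polynomials $p\ne0$ and $q$, $N(p,q)=\#\{x\in\mathbb{R}: p(x)=0,\,q(x)>0\}-\#\{x\in\mathbb{R}: p(x)=0,\,q(x)<0\}$. *Base data:* $\mathtt{base}=\left(\begin{pmatrix}1&1\\1&-1\end{pmatrix},\,[[\,],[0]],\,[[1],[-1]]\right)$. *Combination:* $\mathtt{combine}((qs_1,(M_1,S_1,\Sigma_1)),(qs_2,(M_2,S_2,\Sigma_2)))=(qs,(M,S,\Sigma))$.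 Here $qs$ is the concatenation of $qs_1$ and $qs_2$, and $M$ is the Kronecker product $M_1\otimes M_2$. $S$ lists all concatenations of an entry $I$ of $S_1$ with an entry $J$ of $S_2$ whose indices have all been increased by the length of $qs_1$. $\Sigma$ lists all concatenations of an entry of $\Sigma_1$ with an entry of $\Sigma_2$. In both lists the choice from the first list is the outer loop. *Reduction:* $\mathtt{reduce}(p,(qs,(M,S,\Sigma)))$ returns a triple $(M',S',\Sigma')$. Let $v$ be the vector with entries $v_i=N(p,\prod_{k\in S_i}qs_k)$ and let $w=M^{-1}v$ (if $M$ is not square and invertible, $w$ is some fixed default vector of the right length). Delete from $M$ the columns $j$ with $w_j=0$ and delete the corresponding entries of $\Sigma$, giving a matrix $A$ and the list $\Sigma'$. Let $R$ be the list of column indices of the pivots (first nonzero entries of the nonzero rows) of the reduced row echelon form of $A^T$. Then $M'$ consists of the rows of $A$ indexed by $R$, and $S'$ of the entries of $S$ indexed by $R$. *Recursion:* let $\ell$ be the length of $qs$. - If $\ell=0$: compute $\mathtt{reduce}(p,([1],\mathtt{base}))$, where $[1]$ is the list containing the constant polynomial $1$, and delete the first entry of each sign vector in the third component. - If $\ell=1$: $\mathtt{calc\_data}(p,qs)=\mathtt{reduce}(p,(qs,\mathtt{base}))$. - If $\ell\ge2$: let $qs_1$ be the first $\lfloor \ell/2\rfloor$ entries of $qs$ and $qs_2$ the remaining ones. Then $\mathtt{calc\_data}(p,qs)=\mathtt{reduce}(p,\mathtt{combine}((qs_1,\mathtt{calc\_data}(p,qs_1)),(qs_2,\mathtt{calc\_data}(p,qs_2))))$.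 *)

theory Defs
  imports
    "HOL-Computational_Algebra.Polynomial"
    "Jordan_Normal_Form.Gauss_Jordan_Elimination"
begin

text \<open>
  Signs are represented as the real numbers -1, 0 and 1, so that they are values of \<^const>\<open>sgn\<close>
  on the reals without any conversion.  An element of type sign_data is a triple (M, S, Sigma): the rows of
  M correspond to the index lists in S, the columns to the sign vectors in Sigma.
\<close>

type_synonym sign_data = "rat mat \<times> nat list list \<times> real list list"

text \<open>Meaningful only for nonzero p: the cardinality of an infinite set is 0.\<close>

definition tarski_query :: "real poly \<Rightarrow> real poly \<Rightarrow> int" where
  "tarski_query p q =
     int (card {x. poly p x = 0 \<and> poly q x > 0}) - int (card {x. poly p x = 0 \<and> poly q x < 0})"

definition base_data :: sign_data where
  "base_data = (mat_of_rows_list 2 [[1, 1], [1, -1]], [[], [0]], [[1], [-1]])"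

definition kronecker_product :: "'a :: times mat \<Rightarrow> 'a mat \<Rightarrow> 'a mat" where
  "kronecker_product A B =
     mat (dim_row A * dim_row B) (dim_col A * dim_col B)
       (\<lambda>(i, j). A $$ (i div dim_row B, j div dim_col B) * B $$ (i mod dim_row B, j mod dim_col B))"

fun combine :: "real poly list \<times> sign_data \<Rightarrow> real poly list \<times> sign_data \<Rightarrow> real poly list \<times> sign_data"
  where
  "combine (qs1, (M1, S1, \<Sigma>1)) (qs2, (M2, S2, \<Sigma>2)) =
     (qs1 @ qs2,
      (kronecker_product M1 M2,
       [I @ map (\<lambda>k. k + length qs1) J. I \<leftarrow> S1, J \<leftarrow> S2],
       [\<sigma> @ \<tau>. \<sigma> \<leftarrow> \<Sigma>1, \<tau> \<leftarrow> \<Sigma>2]))"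

definition rhs_vector :: "real poly \<Rightarrow> real poly list \<Rightarrow> nat list list \<Rightarrow> rat vec" where
  "rhs_vector p qs S =
     vec (length S) (\<lambda>i. of_int (tarski_query p (prod_list (map (\<lambda>k. qs ! k) (S ! i)))))"

text \<open>
  The library function \<^const>\<open>mat_inverse\<close> returns \<^const>\<open>None\<close> if the matrix is not square or not
  invertible; the default vector is then the zero vector.
\<close>

definition solve_for_lhs :: "rat mat \<Rightarrow> rat vec \<Rightarrow> rat vec" where
  "solve_for_lhs M v =
     (case mat_inverse M of Some M' \<Rightarrow> M' *\<^sub>v v | None \<Rightarrow> 0\<^sub>v (dim_col M))"

definition take_cols :: "'a mat \<Rightarrow> nat list \<Rightarrow> 'a mat" where
  "take_cols M js = mat_of_cols (dim_row M) (map (col M) js)"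

definition take_rows :: "'a mat \<Rightarrow> nat list \<Rightarrow> 'a mat" where
  "take_rows M rs = mat_of_rows (dim_col M) (map (row M) rs)"

definition rref_pivot_cols :: "'a :: field mat \<Rightarrow> nat list" where
  "rref_pivot_cols B = map snd (pivot_positions (gauss_jordan_single B))"

fun reduce :: "real poly \<Rightarrow> real poly list \<times> sign_data \<Rightarrow> sign_data" where
  "reduce p (qs, (M, S, \<Sigma>)) =
     (let w = solve_for_lhs M (rhs_vector p qs S);
          js = filter (\<lambda>j. w $ j \<noteq> 0) [0..<dim_vec w];
          A = take_cols M js;
          R = rref_pivot_cols (transpose_mat A)
      in (take_rows A R, map (\<lambda>i. S ! i) R, map (\<lambda>j. \<Sigma> ! j) js))"

function calc_data :: "real poly \<Rightarrow> real poly list \<Rightarrow> sign_data" where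
  "calc_data p qs =
     (let len = length qs in
      if len = 0 then
        (case reduce p ([1], base_data) of (M, S, \<Sigma>) \<Rightarrow> (M, S, map tl \<Sigma>))
      else if len = 1 then
        reduce p (qs, base_data)
      else
        (let qs1 = take (len div 2) qs; qs2 = drop (len div 2) qs
         in reduce p (combine (qs1, calc_data p qs1) (qs2, calc_data p qs2))))"
  by pat_completeness auto
termination
proof (relation "measure (\<lambda>(p, qs). length qs)", goal_cases)
  case (3 p qs len qs1 qs2)
  then have "0 < length qs div 2" by linarith
  with 3 show ?case by auto
qed auto

declare calc_data.simps [simp del]

definition find_consistent_signs_at_roots :: "real poly \<Rightarrow> real poly list \<Rightarrow> real list list" where
  "find_consistent_signs_at_roots p qs = (case calc_data p qs of (M, S, \<Sigma>) \<Rightarrow> \<Sigma>)"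

end

theory Submission
  imports Defs "Jordan_Normal_Form.Determinant"
begin

text \<open>
  For distinct candidate sign vectors that include every realized one, let c j be the number of
  roots realizing the j-th candidate. Grouping roots by their sign vector turns each Tarski query
  into a row of the linear system M c = v, so an invertible M determines c, and its nonzero entries
  are exactly the realized sign vectors. The surviving columns of M are independent, and pivots of
  the reduced row echelon form of their transpose select rows that form an invertible matrix again.
  Kronecker products of invertible matrices are invertible, so the argument iterates.
\<close>

section \<open>Kronecker products\<close>

text \<open>Division with remainder by \<open>l\<close> matches the indices below
  \<open>k * l\<close> with pairs \<open>(a, b)\<close>, the inverse being \<open>a * l + b\<close>.
  Kronecker products index their rows and columns in this way.\<close>

lemma sum_div_mod:
  fixes f :: "nat \<Rightarrow> nat \<Rightarrow> 'a :: comm_monoid_add"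
  shows "(\<Sum>t<k * l. f (t div l) (t mod l)) = (\<Sum>a<k. \<Sum>b<l. f a b)"
proof -
  have "(\<Sum>t<k * l. f (t div l) (t mod l)) = (\<Sum>(a, b)\<in>{..<k} \<times> {..<l}. f a b)"
  proof (rule sum.reindex_bij_witness[where i = "\<lambda>(a, b). a * l + b"
        and j = "\<lambda>t. (t div l, t mod l)"])
    fix t assume "t \<in> {..<k * l}"
    then have "t < k * l" by simp
    then show "(t div l, t mod l) \<in> {..<k} \<times> {..<l}"
      by (cases "l = 0") (auto intro: less_mult_imp_div_less)
  next
    fix ab assume "ab \<in> {..<k} \<times> {..<l}"
    then obtain a b where ab: "ab = (a, b)" "a < k" "b < l" by auto
    then have "a * l + b < Suc a * l" by simp
    also have "\<dots> \<le> k * l" using ab by (intro mult_right_mono) auto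
    finally show "(case ab of (a, b) \<Rightarrow> a * l + b) \<in> {..<k * l}" using ab by simp
  qed auto
  then show ?thesis by (simp add: sum.cartesian_product)
qed

lemma kronecker_product_carrier:
  assumes "A \<in> carrier_mat n k" and "B \<in> carrier_mat m l"
  shows "kronecker_product A B \<in> carrier_mat (n * m) (k * l)"
  using assms by (auto simp: kronecker_product_def)

lemma kronecker_product_index:
  assumes "A \<in> carrier_mat n k" and "B \<in> carrier_mat m l" and "i < n * m" and "j < k * l"
  shows "kronecker_product A B $$ (i, j) = A $$ (i div m, j div l) * B $$ (i mod m, j mod l)"
  using assms by (auto simp: kronecker_product_def)

text \<open>The mixed-product property. In each entry of the left side commutativity regroups the
  four factors, and \<open>sum_div_mod\<close> turns the sum over \<open>t\<close> into a double sum
  that is the product of an entry of \<open>A * C\<close> and one of \<open>B * D\<close>.\<close>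

lemma kronecker_product_mult:
  fixes A :: "'a :: comm_semiring_0 mat"
  assumes A: "A \<in> carrier_mat n k" and B: "B \<in> carrier_mat m l"
    and C: "C \<in> carrier_mat k r" and D: "D \<in> carrier_mat l s"
  shows "kronecker_product A B * kronecker_product C D = kronecker_product (A * C) (B * D)"
proof (rule eq_matI)
  note AB = kronecker_product_carrier[OF A B] and CD = kronecker_product_carrier[OF C D]
  have AC: "A * C \<in> carrier_mat n r" and BD: "B * D \<in> carrier_mat m s"
    using A B C D by auto
  note ACBD = kronecker_product_carrier[OF AC BD]
  show "dim_row (kronecker_product A B * kronecker_product C D)
      = dim_row (kronecker_product (A * C) (B * D))"
    and "dim_col (kronecker_product A B * kronecker_product C D)
      = dim_col (kronecker_product (A * C) (B * D))"
    using AB CD ACBD by auto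
  fix i j
  assume "i < dim_row (kronecker_product (A * C) (B * D))"
    and "j < dim_col (kronecker_product (A * C) (B * D))"
  then have i: "i < n * m" and j: "j < r * s" using ACBD by auto
  have m: "m > 0" and s: "s > 0" using i j by (auto intro: gr0I)
  have di: "i div m < n" "i mod m < m" and dj: "j div s < r" "j mod s < s"
    using i j m s by (auto intro: less_mult_imp_div_less)
  have "(kronecker_product A B * kronecker_product C D) $$ (i, j)
      = (\<Sum>t<k * l. kronecker_product A B $$ (i, t) * kronecker_product C D $$ (t, j))"
    using AB CD i j by (auto simp: scalar_prod_def atLeast0LessThan intro!: sum.cong)
  also have "\<dots> = (\<Sum>t<k * l. (A $$ (i div m, t div l) * C $$ (t div l, j div s))
      * (B $$ (i mod m, t mod l) * D $$ (t mod l, j mod s)))"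
    using i j by (intro sum.cong)
      (auto simp: kronecker_product_index[OF A B] kronecker_product_index[OF C D] ac_simps)
  also have "\<dots> = (\<Sum>a<k. \<Sum>b<l. (A $$ (i div m, a) * C $$ (a, j div s))
      * (B $$ (i mod m, b) * D $$ (b, j mod s)))"
    by (rule sum_div_mod)
  also have "\<dots> = (\<Sum>a<k. A $$ (i div m, a) * C $$ (a, j div s))
      * (\<Sum>b<l. B $$ (i mod m, b) * D $$ (b, j mod s))"
    by (simp add: sum_product)
  also have "\<dots> = (A * C) $$ (i div m, j div s) * (B * D) $$ (i mod m, j mod s)"
    using A B C D di dj by (auto simp: scalar_prod_def atLeast0LessThan)
  also have "\<dots> = kronecker_product (A * C) (B * D) $$ (i, j)"
    using kronecker_product_index[OF AC BD i j] by simp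
  finally show "(kronecker_product A B * kronecker_product C D) $$ (i, j)
      = kronecker_product (A * C) (B * D) $$ (i, j)" .
qed

text \<open>An index is determined by its quotient and remainder modulo \<open>m\<close>. With
  \<open>kronecker_product_mult\<close> this makes the Kronecker product of inverses an inverse of
  the Kronecker product.\<close>

lemma kronecker_product_one:
  "kronecker_product (1\<^sub>m n) (1\<^sub>m m) = (1\<^sub>m (n * m) :: 'a :: semiring_1 mat)"
proof (rule eq_matI)
  fix i j
  assume "i < dim_row (1\<^sub>m (n * m) :: 'a mat)" and "j < dim_col (1\<^sub>m (n * m) :: 'a mat)"
  then have i: "i < n * m" and j: "j < n * m" by auto
  then have "m > 0" by (auto intro: gr0I)
  then have "i div m < n" "i mod m < m" "j div m < n" "j mod m < m"
    using i j by (auto intro: less_mult_imp_div_less)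
  moreover have "i div m = j div m \<and> i mod m = j mod m \<longleftrightarrow> i = j"
    by (metis div_mult_mod_eq)
  ultimately show "kronecker_product (1\<^sub>m n) (1\<^sub>m m) $$ (i, j) = (1\<^sub>m (n * m) :: 'a mat) $$ (i, j)"
    using i j by (auto simp: kronecker_product_index[OF one_carrier_mat one_carrier_mat])
qed (auto simp: kronecker_product_def)

section \<open>Selecting rows by pivots\<close>

lemma take_rows_carrier: "take_rows M rs \<in> carrier_mat (length rs) (dim_col M)"
  by (auto simp: take_rows_def mat_of_rows_def)

lemma take_cols_carrier: "take_cols M js \<in> carrier_mat (dim_row M) (length js)"
  by (auto simp: take_cols_def mat_of_cols_def)

lemma take_rows_index:
  assumes "i < length rs" and "rs ! i < dim_row M" and "j < dim_col M"
  shows "take_rows M rs $$ (i, j) = M $$ (rs ! i, j)"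
  using assms by (simp add: take_rows_def mat_of_rows_index)

lemma take_cols_index:
  assumes "j < length js" and "js ! j < dim_col M" and "i < dim_row M"
  shows "take_cols M js $$ (i, j) = M $$ (i, js ! j)"
  using assms by (simp add: take_cols_def mat_of_cols_index)

text \<open>The reduced row echelon form of the transpose has a right inverse because
  \<open>A\<close> has a left inverse, so none of its \<open>r\<close> rows vanishes and there are
  \<open>r\<close> pivots. Its pivot columns are unit vectors, and undoing the row operations shows
  that the rows of \<open>A\<close> chosen by the pivots form an invertible matrix.\<close>

lemma rref_pivot_cols_transpose:
  fixes A :: "'a :: field mat"
  assumes A: "A \<in> carrier_mat n r" and X: "X \<in> carrier_mat r n" and XA: "X * A = 1\<^sub>m r"
  defines "R \<equiv> rref_pivot_cols (transpose_mat A)"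
  shows "length R = r" and "\<And>i. i < r \<Longrightarrow> R ! i < n"
    and "\<exists>N\<in>carrier_mat r r. take_rows A R * N = 1\<^sub>m r"
proof -
  define B where "B = transpose_mat A"
  define G where "G = gauss_jordan_single B"
  define pp where "pp = pivot_positions G"
  have B: "B \<in> carrier_mat r n" using A by (simp add: B_def)
  have R: "R = map snd pp" by (simp add: R_def pp_def G_def B_def rref_pivot_cols_def)
  note gj = gauss_jordan_single[OF B G_def[symmetric]]
  have G: "G \<in> carrier_mat r n" by (rule gj(2))
  from gj(3) G obtain f where pf: "pivot_fun G f n"
    by (auto simp: row_echelon_form_def)
  \<comment> \<open>\<open>P\<close> collects the row operations that lead from \<open>B\<close> to
    \<open>G\<close>, and \<open>Q\<close> undoes them.\<close>
  from gj(4) obtain P Q where P: "P \<in> carrier_mat r r" and Q: "Q \<in> carrier_mat r r"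
    and GPB: "G = P * B" and PQ: "P * Q = 1\<^sub>m r" by blast
  have BX: "B * transpose_mat X = 1\<^sub>m r"
    using transpose_mult[OF X A] XA by (simp add: B_def)
  have XQ: "transpose_mat X * Q \<in> carrier_mat n r" using X Q by simp
  have GXQ: "G * (transpose_mat X * Q) = 1\<^sub>m r"
  proof -
    have "G * (transpose_mat X * Q) = G * transpose_mat X * Q"
      using G X Q by (intro assoc_mult_mat[symmetric]) auto
    also have "G * transpose_mat X = P * (B * transpose_mat X)"
      unfolding GPB using P B X by (intro assoc_mult_mat) auto
    finally show ?thesis using BX P PQ by simp
  qed
  \<comment> \<open>A zero row of \<open>G\<close> would make a diagonal entry of
    \<open>G * (transpose_mat X * Q)\<close>, which is the identity, equal to 0.\<close>
  have nz: "row G i \<noteq> 0\<^sub>v n" if i: "i < r" for i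
  proof
    assume z: "row G i = 0\<^sub>v n"
    have "(G * (transpose_mat X * Q)) $$ (i, i) = row G i \<bullet> col (transpose_mat X * Q) i"
      using G XQ i by (intro index_mult_mat(1)) auto
    also have "\<dots> = 0" unfolding z using XQ i by (intro scalar_prod_left_zero) auto
    finally show False using GXQ i by simp
  qed
  note pos = pivot_positions[OF G pf, folded pp_def]
  have "{i. i < r \<and> row G i \<noteq> 0\<^sub>v n} = {..<r}" using nz by auto
  then have len: "length pp = r" using pos(4) by simp
  have dimG: "dim_row G = r" using G by simp
  note pfD = pivot_funD[OF dimG pf]
  have pp: "fst (pp ! k) < r" "snd (pp ! k) = f (fst (pp ! k))" "f (fst (pp ! k)) < n"
    if "k < r" for k
  proof -
    have "pp ! k \<in> set pp" using that len by simp
    then obtain i where "pp ! k = (i, f i)" "i < r" "f i \<noteq> n" using pos(1) by auto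
    then show "fst (pp ! k) < r" "snd (pp ! k) = f (fst (pp ! k))" "f (fst (pp ! k)) < n"
      using pfD(1)[of i] by auto
  qed
  have inj: "fst (pp ! k) = fst (pp ! l) \<longleftrightarrow> k = l" if "k < r" "l < r" for k l
    using nth_eq_iff_index_eq[OF pos(2), of k l] that len by simp
  show lenR: "length R = r" using len R by simp
  show Rlt: "R ! i < n" if "i < r" for i using pp[OF that] that len R by simp
  \<comment> \<open>Column \<open>k\<close> of \<open>N\<close> is the row of \<open>P\<close> that
    belongs to the \<open>k\<close>-th listed pivot. Going through \<open>fst (pp ! k)\<close> makes
    the argument independent of the order in which the pivots are listed.\<close>
  define N where "N = mat r r (\<lambda>(j, k). P $$ (fst (pp ! k), j))"
  have "take_rows A R * N = 1\<^sub>m r"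
  proof (rule eq_matI)
    fix l k assume "l < dim_row (1\<^sub>m r :: 'a mat)" "k < dim_col (1\<^sub>m r :: 'a mat)"
    then have lk: "l < r" "k < r" by auto
    have "(take_rows A R * N) $$ (l, k)
        = (\<Sum>j<r. take_rows A R $$ (l, j) * N $$ (j, k))"
      using take_rows_carrier[of A R] A lenR lk
      by (auto simp: N_def scalar_prod_def atLeast0LessThan intro!: sum.cong)
    also have "\<dots> = (\<Sum>j<r. P $$ (fst (pp ! k), j) * B $$ (j, R ! l))"
      using lk A lenR Rlt by (intro sum.cong) (auto simp: N_def take_rows_index B_def)
    also have "\<dots> = G $$ (fst (pp ! k), R ! l)"
      unfolding GPB using P B Rlt[OF lk(1)] pp(1)[OF lk(2)]
      by (auto simp: scalar_prod_def atLeast0LessThan)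
    also have "R ! l = f (fst (pp ! l))" using pp(2)[OF lk(1)] R len lk by simp
    \<comment> \<open>In reduced form a pivot column has 1 in its pivot row and 0 in all other
      rows.\<close>
    also have "G $$ (fst (pp ! k), f (fst (pp ! l))) = (if l = k then 1 else 0)"
      using pfD(4)[of "fst (pp ! l)"] pfD(5)[of "fst (pp ! l)" "fst (pp ! k)"] pp lk inj[of k l]
      by auto
    finally show "(take_rows A R * N) $$ (l, k) = 1\<^sub>m r $$ (l, k)" using lk by simp
  qed (use lenR in \<open>simp_all add: N_def take_rows_def\<close>)
  moreover have "N \<in> carrier_mat r r" by (simp add: N_def)
  ultimately show "\<exists>N\<in>carrier_mat r r. take_rows A R * N = 1\<^sub>m r" by blast
qed

text \<open>The product is the submatrix of \<open>N * M\<close> with rows and columns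
  \<open>js\<close>. Since \<open>js\<close> has no repetitions, this submatrix of the identity is
  again an identity.\<close>

lemma take_cols_left_invertible:
  fixes M :: "'a :: semiring_1 mat"
  assumes M: "M \<in> carrier_mat n m" and N: "N \<in> carrier_mat m n" and NM: "N * M = 1\<^sub>m m"
    and js: "distinct js" "set js \<subseteq> {..<m}"
  shows "take_rows N js * take_cols M js = 1\<^sub>m (length js)"
proof (rule eq_matI)
  fix k l
  assume "k < dim_row (1\<^sub>m (length js) :: 'a mat)" "l < dim_col (1\<^sub>m (length js) :: 'a mat)"
  then have kl: "k < length js" "l < length js" by auto
  then have jkl: "js ! k < m" "js ! l < m" using js nth_mem by blast+
  have "(take_rows N js * take_cols M js) $$ (k, l)
      = (\<Sum>t<n. take_rows N js $$ (k, t) * take_cols M js $$ (t, l))"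
    using take_rows_carrier[of N js] take_cols_carrier[of M js] M N kl
    by (auto simp: scalar_prod_def atLeast0LessThan intro!: sum.cong)
  also have "\<dots> = (\<Sum>t<n. N $$ (js ! k, t) * M $$ (t, js ! l))"
    using kl jkl M N by (intro sum.cong) (auto simp: take_rows_index take_cols_index)
  also have "\<dots> = (N * M) $$ (js ! k, js ! l)"
    using M N jkl by (auto simp: scalar_prod_def atLeast0LessThan)
  also have "\<dots> = 1\<^sub>m (length js) $$ (k, l)"
    using NM kl jkl js(1) by (simp add: nth_eq_iff_index_eq)
  finally show "(take_rows N js * take_cols M js) $$ (k, l) = 1\<^sub>m (length js) $$ (k, l)" .
qed (auto simp: take_rows_def take_cols_def)

text \<open>For invertible \<open>M\<close> the zero default in \<open>solve_for_lhs\<close> never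
  arises, and multiplying \<open>M *\<^sub>v c = v\<close> by the computed inverse recovers
  \<open>c\<close>.\<close>

lemma solve_for_lhs_unique:
  assumes M: "M \<in> carrier_mat m m" and N: "N \<in> carrier_mat m m" and MN: "M * N = 1\<^sub>m m"
    and c: "c \<in> carrier_vec m" and eq: "M *\<^sub>v c = v"
  shows "solve_for_lhs M v = c"
proof (cases "mat_inverse M")
  case None
  have "N * M = 1\<^sub>m m" by (rule mat_mult_left_right_inverse[OF M N MN])
  \<comment> \<open>The result \<open>None\<close> would mean that \<open>M\<close> is not a unit of
    the matrix ring; \<open>undefined\<close> only fills an arbitrary parameter of
    \<open>ring_mat\<close>.\<close>
  then have "M \<in> Units (ring_mat TYPE(rat) m undefined)"
    using M N MN by (auto simp: Units_def ring_mat_def)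
  then show ?thesis using mat_inverse(1)[OF M None, of undefined] by blast
next
  case (Some M')
  then have M': "M' * M = 1\<^sub>m m" "M' \<in> carrier_mat m m" using mat_inverse(2)[OF M] by auto
  have "M' *\<^sub>v v = (M' * M) *\<^sub>v c" unfolding eq[symmetric]
    using assoc_mult_mat_vec[OF M'(2) M c] by simp
  then show ?thesis using Some M'(1) c by (simp add: solve_for_lhs_def)
qed

section \<open>The matrix equation\<close>

definition sign_vector :: "real poly list \<Rightarrow> real \<Rightarrow> real list" where
  "sign_vector qs x = map (\<lambda>q. sgn (poly q x)) qs"

definition consistent_signs :: "real poly \<Rightarrow> real poly list \<Rightarrow> real list set" where
  "consistent_signs p qs = sign_vector qs ` {x. poly p x = 0}"

text \<open>The invariant of the recursion. Entry \<open>(i, j)\<close> of \<open>M\<close> is the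
  sign that the product of the polynomials indexed by \<open>S ! i\<close> has wherever
  \<open>qs\<close> has sign vector \<open>\<Sigma> ! j\<close>. The candidates in
  \<open>\<Sigma>\<close> may include unrealized ones. Since \<open>M\<close> is square, a right
  inverse expresses its invertibility.\<close>

fun matrix_equation_data :: "real poly \<Rightarrow> real poly list \<Rightarrow> sign_data \<Rightarrow> bool" where
  "matrix_equation_data p qs (M, S, \<Sigma>) \<longleftrightarrow>
     length S = length \<Sigma> \<and> M \<in> carrier_mat (length \<Sigma>) (length \<Sigma>) \<and>
     (\<exists>N\<in>carrier_mat (length \<Sigma>) (length \<Sigma>). M * N = 1\<^sub>m (length \<Sigma>)) \<and>
     (\<forall>I\<in>set S. \<forall>k\<in>set I. k < length qs) \<and>
     (\<forall>i<length \<Sigma>. \<forall>j<length \<Sigma>.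
        real_of_rat (M $$ (i, j)) = prod_list (map (\<lambda>k. \<Sigma> ! j ! k) (S ! i))) \<and>
     distinct \<Sigma> \<and> (\<forall>\<sigma>\<in>set \<Sigma>. length \<sigma> = length qs) \<and> consistent_signs p qs \<subseteq> set \<Sigma>"

text \<open>The sign of a real is the indicator of being positive minus the indicator of being
  negative, and \<open>p\<close> has finitely many roots, so the two sums are the cardinalities in
  the query.\<close>

lemma tarski_query_eq_sum_sgn:
  assumes "p \<noteq> 0"
  shows "real_of_int (tarski_query p q) = (\<Sum>x | poly p x = 0. sgn (poly q x))"
proof -
  have fin: "finite {x. poly p x = 0}" using assms by (rule poly_roots_finite)
  have "(\<Sum>x | poly p x = 0. sgn (poly q x))
      = (\<Sum>x | poly p x = 0. of_bool (poly q x > 0) - of_bool (poly q x < 0))"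
    by (intro sum.cong) (auto simp: sgn_if)
  also have "\<dots> = (\<Sum>x | poly p x = 0. of_bool (poly q x > 0))
      - (\<Sum>x | poly p x = 0. of_bool (poly q x < 0))"
    by (rule sum_subtractf)
  also have "\<dots> = real_of_int (tarski_query p q)"
    using fin by (simp add: tarski_query_def Int_def)
  finally show ?thesis by simp
qed

lemma sgn_poly_prod_list:
  assumes "\<forall>k\<in>set I. k < length qs"
  shows "sgn (poly (prod_list (map (\<lambda>k. qs ! k) I)) x)
       = prod_list (map (\<lambda>k. sign_vector qs x ! k) I)"
  using assms
proof (induction I)
  case (Cons k I)
  then have "sign_vector qs x ! k = sgn (poly (qs ! k) x)" by (simp add: sign_vector_def)
  with Cons show ?case by (simp add: sgn_mult)
qed simp

text \<open>A root with sign vector \<open>\<Sigma> ! j\<close> contributes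
  \<open>M $$ (i, j)\<close> to the \<open>i\<close>-th Tarski query. The computation runs in the
  reals, where the signs live, and returns to the rationals by injectivity of
  \<open>real_of_rat\<close>.\<close>

lemma matrix_equation:
  assumes p: "p \<noteq> 0" and d: "matrix_equation_data p qs (M, S, \<Sigma>)"
  shows "M *\<^sub>v vec (length \<Sigma>) (\<lambda>j. of_nat (card {x. poly p x = 0 \<and> sign_vector qs x = \<Sigma> ! j}))
       = rhs_vector p qs S" (is "M *\<^sub>v vec ?m ?c = _")
proof (rule eq_vecI)
  have M: "M \<in> carrier_mat ?m ?m" and S: "length S = ?m" and dist: "distinct \<Sigma>"
    and cons: "consistent_signs p qs \<subseteq> set \<Sigma>" using d by auto
  show "dim_vec (M *\<^sub>v vec ?m ?c) = dim_vec (rhs_vector p qs S)"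
    using M S by (simp add: rhs_vector_def)
  fix i assume "i < dim_vec (rhs_vector p qs S)"
  then have i: "i < ?m" using S by (simp add: rhs_vector_def)
  have "S ! i \<in> set S" using i S by simp
  then have I: "\<forall>k\<in>set (S ! i). k < length qs" using d by auto
  define h where "h \<sigma> = prod_list (map (\<lambda>k. \<sigma> ! k) (S ! i))" for \<sigma> :: "real list"
  have Mh: "real_of_rat (M $$ (i, j)) = h (\<Sigma> ! j)" if "j < ?m" for j
    using d i that by (simp add: h_def)
  have fin: "finite {x. poly p x = 0}" using p by (rule poly_roots_finite)
  have "(M *\<^sub>v vec ?m ?c) $ i = (\<Sum>j<?m. M $$ (i, j) * ?c j)"
    using M i by (auto simp: scalar_prod_def atLeast0LessThan)
  then have "real_of_rat ((M *\<^sub>v vec ?m ?c) $ i) = (\<Sum>j<?m. real_of_rat (M $$ (i, j)) *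
      card {x. poly p x = 0 \<and> sign_vector qs x = \<Sigma> ! j})"
    by (simp add: of_rat_sum of_rat_mult)
  also have "\<dots> = (\<Sum>j<?m. h (\<Sigma> ! j) * card {x. poly p x = 0 \<and> sign_vector qs x = \<Sigma> ! j})"
    by (intro sum.cong) (simp_all add: Mh)
  \<comment> \<open>Distinctness of \<open>\<Sigma>\<close> lets positions be replaced by sign
    vectors without counting any twice.\<close>
  also have "\<dots> = (\<Sum>\<sigma>\<in>set \<Sigma>. h \<sigma> * card {x. poly p x = 0 \<and> sign_vector qs x = \<sigma>})"
    by (rule sum.reindex_bij_betw[OF bij_betw_nth[OF dist refl refl]])
  also have "\<dots> = (\<Sum>\<sigma>\<in>set \<Sigma>. \<Sum>x\<in>{x\<in>{x. poly p x = 0}. sign_vector qs x = \<sigma>}. h (sign_vector qs x))"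
    by (intro sum.cong) auto
  \<comment> \<open>The fibres of \<open>sign_vector qs\<close> over \<open>set \<Sigma>\<close>
    cover all roots, because every realized sign vector is a candidate.\<close>
  also have "\<dots> = (\<Sum>x | poly p x = 0. h (sign_vector qs x))"
    using fin cons by (intro sum.group) (auto simp: consistent_signs_def)
  also have "\<dots> = real_of_int (tarski_query p (prod_list (map (\<lambda>k. qs ! k) (S ! i))))"
    unfolding tarski_query_eq_sum_sgn[OF p] h_def sgn_poly_prod_list[OF I] by (rule refl)
  also have "\<dots> = real_of_rat (rhs_vector p qs S $ i)"
    using i S by (simp add: rhs_vector_def)
  finally show "(M *\<^sub>v vec ?m ?c) $ i = rhs_vector p qs S $ i" by simp
qed

text \<open>The solution of the system is the vector of root counts, so deleting its zero positions
  keeps exactly the realized candidates. The deleted columns leave a tall matrix; the pivot rows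
  make it square and invertible again, which restores the invariant.\<close>

lemma reduce_correct:
  assumes p: "p \<noteq> 0" and d: "matrix_equation_data p qs (M, S, \<Sigma>)"
    and red: "reduce p (qs, (M, S, \<Sigma>)) = (M', S', \<Sigma>')"
  shows "matrix_equation_data p qs (M', S', \<Sigma>')" and "set \<Sigma>' = consistent_signs p qs"
proof -
  define m where "m = length \<Sigma>"
  define c where "c = vec m
    (\<lambda>j. of_nat (card {x. poly p x = 0 \<and> sign_vector qs x = \<Sigma> ! j}) :: rat)"
  define js where "js = filter (\<lambda>j. c $ j \<noteq> 0) [0..<m]"
  define A where "A = take_cols M js"
  define R where "R = rref_pivot_cols (transpose_mat A)"
  from d obtain N where M: "M \<in> carrier_mat m m" and N: "N \<in> carrier_mat m m"
    and MN: "M * N = 1\<^sub>m m" and S: "length S = m"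
    by (auto simp: m_def)
  have c: "c \<in> carrier_vec m" by (simp add: c_def)
  have "solve_for_lhs M (rhs_vector p qs S) = c"
    using matrix_equation[OF p d] by (intro solve_for_lhs_unique[OF M N MN c]) (simp add: c_def m_def)
  then have red': "M' = take_rows A R" "S' = map (\<lambda>i. S ! i) R" "\<Sigma>' = map (\<lambda>j. \<Sigma> ! j) js"
    using red c by (auto simp: Let_def js_def A_def R_def)
  have NM: "N * M = 1\<^sub>m m" by (rule mat_mult_left_right_inverse[OF M N MN])
  have js: "distinct js" "set js \<subseteq> {..<m}" by (auto simp: js_def)
  define r where "r = length js"
  have A: "A \<in> carrier_mat m r" using take_cols_carrier[of M js] M by (simp add: A_def r_def)
  have X: "take_rows N js \<in> carrier_mat r m"
    using take_rows_carrier[of N js] N by (simp add: r_def)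
  \<comment> \<open>The rows \<open>js\<close> of the inverse form a left inverse of the surviving
    columns, which is what the choice of pivot rows requires.\<close>
  have XA: "take_rows N js * A = 1\<^sub>m r"
    unfolding A_def r_def by (rule take_cols_left_invertible[OF M N NM js])
  note piv = rref_pivot_cols_transpose[OF A X XA, folded R_def]
  have fin: "finite {x. poly p x = 0}" using p by (rule poly_roots_finite)
  \<comment> \<open>Finiteness matters here: only for a finite set does cardinality 0 mean that no
    root realizes the candidate.\<close>
  have c_nz: "c $ j \<noteq> 0 \<longleftrightarrow> \<Sigma> ! j \<in> consistent_signs p qs" if "j < m" for j
  proof -
    have "finite {x. poly p x = 0 \<and> sign_vector qs x = \<Sigma> ! j}"
      by (rule finite_subset[OF _ fin]) auto
    then show ?thesis
      using that by (auto simp: c_def consistent_signs_def intro: rev_image_eqI)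
  qed
  have "consistent_signs p qs \<subseteq> set \<Sigma>" using d by simp
  then show set_eq: "set \<Sigma>' = consistent_signs p qs"
    using c_nz by (fastforce simp: red'(3) js_def m_def in_set_conv_nth)
  have M': "M' \<in> carrier_mat r r"
    using take_rows_carrier[of A R] A piv(1) by (simp add: red'(1))
  have jlt: "js ! j < m" if "j < r" for j using js that nth_mem unfolding r_def by blast
  have "real_of_rat (M' $$ (i, j)) = prod_list (map (\<lambda>k. \<Sigma>' ! j ! k) (S' ! i))"
    if ij: "i < r" "j < r" for i j
  proof -
    have "M' $$ (i, j) = A $$ (R ! i, j)"
      using ij piv A by (simp add: red'(1) take_rows_index)
    also have "\<dots> = M $$ (R ! i, js ! j)"
      unfolding A_def using ij piv(2) jlt M by (intro take_cols_index) (auto simp: r_def)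
    finally have "real_of_rat (M' $$ (i, j)) = prod_list (map (\<lambda>k. \<Sigma> ! (js ! j) ! k) (S ! (R ! i)))"
      using d piv(2)[OF ij(1)] jlt[OF ij(2)] by (simp add: m_def)
    then show ?thesis using ij piv(1) by (simp add: red' r_def)
  qed
  moreover have "length \<Sigma>' = r" and "length S' = r" using piv(1) by (simp_all add: red' r_def)
  moreover have "distinct \<Sigma>'"
    using d js by (auto simp: red'(3) distinct_map m_def intro!: inj_on_nth)
  moreover have "set S' \<subseteq> set S"
    using piv(1,2) S nth_mem[of _ S] by (auto simp: red'(2) in_set_conv_nth[of _ R])
  moreover have "set \<Sigma>' \<subseteq> set \<Sigma>" using js by (auto simp: red'(3) m_def)
  ultimately show "matrix_equation_data p qs (M', S', \<Sigma>')"
    using d M' piv(3) set_eq by (auto simp: red'(1))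
qed

section \<open>The recursion\<close>

text \<open>Only an inclusion, since two realized halves need not come from a common root. The next
  reduction removes the surplus combinations.\<close>

lemma consistent_signs_append:
  "consistent_signs p (qs @ qs') \<subseteq> (\<lambda>(\<sigma>, \<tau>). \<sigma> @ \<tau>) ` (consistent_signs p qs \<times> consistent_signs p qs')"
  by (force simp: consistent_signs_def sign_vector_def)

text \<open>The product of signs over a concatenated index list splits into a part for
  \<open>qs1\<close> and a part for \<open>qs2\<close>, so the new matrix entries are products of
  old ones, which is the Kronecker product.\<close>

lemma matrix_equation_data_combine:
  assumes d1: "matrix_equation_data p qs1 (M1, S1, \<Sigma>1)"
    and d2: "matrix_equation_data p qs2 (M2, S2, \<Sigma>2)"
    and comb: "combine (qs1, (M1, S1, \<Sigma>1)) (qs2, (M2, S2, \<Sigma>2)) = (qs, (M, S, \<Sigma>))"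
  shows "matrix_equation_data p qs (M, S, \<Sigma>)"
proof -
  define n m where "n = length \<Sigma>1" and "m = length \<Sigma>2"
  have qs: "qs = qs1 @ qs2" and M: "M = kronecker_product M1 M2"
    \<comment> \<open>Written over \<open>List.product\<close>, the \<open>i\<close>-th entry comes
      from positions \<open>i div m\<close> and \<open>i mod m\<close>, the same index split as in
      the Kronecker product.\<close>
    and S: "S = map (\<lambda>(I, J). I @ map (\<lambda>k. k + length qs1) J) (List.product S1 S2)"
    and \<Sigma>: "\<Sigma> = map (\<lambda>(\<sigma>, \<tau>). \<sigma> @ \<tau>) (List.product \<Sigma>1 \<Sigma>2)"
    using comb by (auto simp: product_concat_map map_concat o_def)
  from d1 obtain N1 where M1: "M1 \<in> carrier_mat n n" and N1: "N1 \<in> carrier_mat n n"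
    and MN1: "M1 * N1 = 1\<^sub>m n" and S1: "length S1 = n" by (auto simp: n_def)
  from d2 obtain N2 where M2: "M2 \<in> carrier_mat m m" and N2: "N2 \<in> carrier_mat m m"
    and MN2: "M2 * N2 = 1\<^sub>m m" and S2: "length S2 = m" by (auto simp: m_def)
  have len: "length \<Sigma> = n * m" "length S = n * m"
    by (simp_all add: \<Sigma> S S1 S2 n_def m_def)
  have inv: "M * kronecker_product N1 N2 = 1\<^sub>m (n * m)"
    by (simp add: M kronecker_product_mult[OF M1 M2 N1 N2] MN1 MN2 kronecker_product_one)
  have entry: "real_of_rat (M $$ (i, j)) = prod_list (map (\<lambda>k. \<Sigma> ! j ! k) (S ! i))"
    if ij: "i < n * m" "j < n * m" for i j
  proof -
    have "m > 0" using ij by (auto intro: gr0I)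
    then have b: "i div m < n" "i mod m < m" "j div m < n" "j mod m < m"
      using ij by (auto intro: less_mult_imp_div_less)
    define I J \<sigma> \<tau> where "I = S1 ! (i div m)" and "J = S2 ! (i mod m)"
      and "\<sigma> = \<Sigma>1 ! (j div m)" and "\<tau> = \<Sigma>2 ! (j mod m)"
    have Si: "S ! i = I @ map (\<lambda>k. k + length qs1) J" and \<Sigma>j: "\<Sigma> ! j = \<sigma> @ \<tau>"
      using ij S1 S2 by (simp_all add: S \<Sigma> product_nth I_def J_def \<sigma>_def \<tau>_def n_def m_def)
    have "I \<in> set S1" "\<sigma> \<in> set \<Sigma>1" using b S1 by (simp_all add: I_def \<sigma>_def n_def)
    then have I: "\<forall>k\<in>set I. k < length \<sigma>" and \<sigma>: "length \<sigma> = length qs1" using d1 by auto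
    \<comment> \<open>Indices in \<open>I\<close> stay inside \<open>\<sigma>\<close>, while the
      shift by \<open>length qs1\<close>, the length of \<open>\<sigma>\<close>, moves those of
      \<open>J\<close> exactly onto \<open>\<tau>\<close>.\<close>
    have "map (\<lambda>k. (\<sigma> @ \<tau>) ! k) I = map (\<lambda>k. \<sigma> ! k) I"
      using I by (intro map_cong) (auto simp: nth_append)
    moreover have "map (\<lambda>k. (\<sigma> @ \<tau>) ! k) (map (\<lambda>k. k + length qs1) J) = map (\<lambda>k. \<tau> ! k) J"
      using \<sigma> by (simp add: nth_append)
    moreover have "M $$ (i, j) = M1 $$ (i div m, j div m) * M2 $$ (i mod m, j mod m)"
      unfolding M by (rule kronecker_product_index[OF M1 M2 ij])
    moreover have "real_of_rat (M1 $$ (i div m, j div m)) = prod_list (map (\<lambda>k. \<sigma> ! k) I)"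
      and "real_of_rat (M2 $$ (i mod m, j mod m)) = prod_list (map (\<lambda>k. \<tau> ! k) J)"
      using d1 d2 b by (simp_all add: I_def J_def \<sigma>_def \<tau>_def n_def m_def)
    ultimately show ?thesis
      unfolding Si \<Sigma>j map_append prod_list.append by (simp only: of_rat_mult)
  qed
  \<comment> \<open>All vectors in \<open>\<Sigma>1\<close> have the same length, so a concatenation
    determines its two parts.\<close>
  have "inj_on (\<lambda>(\<sigma>, \<tau>). \<sigma> @ \<tau>) (set \<Sigma>1 \<times> set \<Sigma>2)"
    using d1 by (intro inj_onI) auto
  then have "distinct \<Sigma>"
    using d1 d2 by (simp add: \<Sigma> distinct_map distinct_product)
  moreover have "\<forall>\<sigma>\<in>set \<Sigma>. length \<sigma> = length qs" using d1 d2 by (auto simp: \<Sigma> qs)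
  moreover have "\<forall>I\<in>set S. \<forall>k\<in>set I. k < length qs"
    using d1 d2 by (fastforce simp: S qs)
  moreover have "consistent_signs p qs \<subseteq> set \<Sigma>"
  proof -
    have "consistent_signs p qs1 \<subseteq> set \<Sigma>1" "consistent_signs p qs2 \<subseteq> set \<Sigma>2"
      using d1 d2 by auto
    then show ?thesis
      using consistent_signs_append[of p qs1 qs2] by (fastforce simp: \<Sigma> qs)
  qed
  moreover have "M \<in> carrier_mat (n * m) (n * m)"
    unfolding M by (rule kronecker_product_carrier[OF M1 M2])
  ultimately show ?thesis
    using len inv entry kronecker_product_carrier[OF N1 N2] by auto
qed

text \<open>Coprimality excludes a common root, so the sign 0 never occurs and the candidates 1 and
  -1 suffice.\<close>

lemma matrix_equation_data_base:
  assumes "coprime q p"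
  shows "matrix_equation_data p [q] base_data"
proof -
  let ?M = "mat_of_rows_list 2 [[1, 1], [1, -1]] :: rat mat"
  \<comment> \<open>The square of \<open>?M\<close> is twice the identity, so half of
    \<open>?M\<close> is its inverse.\<close>
  let ?N = "mat_of_rows_list 2 [[1 / 2, 1 / 2], [1 / 2, - 1 / 2]] :: rat mat"
  have "?M * ?N = 1\<^sub>m 2"
    by (rule eq_matI) (auto simp: mat_of_rows_list_def scalar_prod_def numeral_2_eq_2 less_Suc_eq)
  moreover have "?M \<in> carrier_mat 2 2" "?N \<in> carrier_mat 2 2"
    by (auto simp: mat_of_rows_list_def)
  moreover have "poly q x \<noteq> 0" if "poly p x = 0" for x
    using coprime_poly_0[OF assms, of x] that by auto
  then have "consistent_signs p [q] \<subseteq> {[1], [- 1]}"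
    by (auto simp: consistent_signs_def sign_vector_def sgn_if)
  moreover have "real_of_rat (?M $$ (i, j)) = prod_list (map (\<lambda>k. [[1], [- 1]] ! j ! k) ([[], [0]] ! i))"
    if "i < 2" "j < 2" for i j
    using that by (auto simp: mat_of_rows_list_def less_2_cases_iff of_rat_minus)
  ultimately show ?thesis
    by (auto simp: base_data_def numeral_2_eq_2)
qed

text \<open>Induction on the length, as the recursion halves the list. The empty list is kept apart:
  its matrix and index lists are computed for \<open>[1]\<close>.\<close>

lemma calc_data_correct:
  assumes p: "p \<noteq> 0"
  shows "qs \<noteq> [] \<Longrightarrow> (\<And>q. q \<in> set qs \<Longrightarrow> coprime q p) \<Longrightarrow> calc_data p qs = (M, S, \<Sigma>) \<Longrightarrow>
    matrix_equation_data p qs (M, S, \<Sigma>) \<and> set \<Sigma> = consistent_signs p qs"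
proof (induction "length qs" arbitrary: qs M S \<Sigma> rule: less_induct)
  case less
  show ?case
  proof (cases "length qs = 1")
    case True
    then obtain q where q: "qs = [q]" by (auto simp: length_Suc_conv)
    obtain M0 S0 \<Sigma>0 where base: "base_data = (M0, S0, \<Sigma>0)" by (cases base_data)
    have "reduce p (qs, (M0, S0, \<Sigma>0)) = (M, S, \<Sigma>)"
      using less.prems(3) True by (simp add: calc_data.simps[of p qs] base)
    moreover have "matrix_equation_data p qs (M0, S0, \<Sigma>0)"
      using matrix_equation_data_base[of q p] less.prems(2) by (simp add: q base)
    ultimately show ?thesis using reduce_correct[OF p] by blast
  next
    case False
    define qs1 qs2 where "qs1 = take (length qs div 2) qs" and "qs2 = drop (length qs div 2) qs"
    \<comment> \<open>From length 2 on, both halves are nonempty and strictly shorter, so the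
      induction hypothesis applies to each.\<close>
    have "length qs \<ge> 2" using False less.prems(1) by (cases qs) (auto simp: Suc_le_eq)
    then have len: "length qs1 < length qs" "length qs2 < length qs" "qs1 \<noteq> []" "qs2 \<noteq> []"
      by (auto simp: qs1_def qs2_def)
    have sub: "set qs1 \<subseteq> set qs" "set qs2 \<subseteq> set qs"
      by (auto simp: qs1_def qs2_def dest: in_set_takeD in_set_dropD)
    obtain M1 S1 \<Sigma>1 where c1: "calc_data p qs1 = (M1, S1, \<Sigma>1)" by (cases "calc_data p qs1")
    obtain M2 S2 \<Sigma>2 where c2: "calc_data p qs2 = (M2, S2, \<Sigma>2)" by (cases "calc_data p qs2")
    obtain M0 S0 \<Sigma>0 where comb:
      "combine (qs1, (M1, S1, \<Sigma>1)) (qs2, (M2, S2, \<Sigma>2)) = (qs, (M0, S0, \<Sigma>0))"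
      by (simp add: qs1_def qs2_def)
    have "matrix_equation_data p qs1 (M1, S1, \<Sigma>1)" "matrix_equation_data p qs2 (M2, S2, \<Sigma>2)"
      using less.hyps[OF len(1) len(3) _ c1] less.hyps[OF len(2) len(4) _ c2] less.prems(2) sub
      by blast+
    then have "matrix_equation_data p qs (M0, S0, \<Sigma>0)"
      using comb by (rule matrix_equation_data_combine)
    moreover have "calc_data p qs = reduce p (combine (qs1, calc_data p qs1) (qs2, calc_data p qs2))"
      using False less.prems(1) by (subst calc_data.simps) (simp add: Let_def qs1_def qs2_def)
    then have "reduce p (qs, (M0, S0, \<Sigma>0)) = (M, S, \<Sigma>)"
      using less.prems(3) comb by (simp only: c1 c2)
    ultimately show ?thesis using reduce_correct[OF p] by blast
  qed
qed

text \<open>The constant 1 is coprime to \<open>p\<close> and has sign 1 at every root. Dropping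
  this sign leaves the empty vector if \<open>p\<close> has a real root, and no vector at all
  otherwise.\<close>

lemma find_consistent_signs_at_roots_Nil:
  assumes "p \<noteq> 0"
  shows "set (find_consistent_signs_at_roots p []) = consistent_signs p []"
proof -
  obtain M0 S0 \<Sigma>0 where base: "base_data = (M0, S0, \<Sigma>0)" by (cases base_data)
  obtain M S \<Sigma> where red: "reduce p ([1], (M0, S0, \<Sigma>0)) = (M, S, \<Sigma>)"
    by (cases "reduce p ([1], (M0, S0, \<Sigma>0))")
  have "set \<Sigma> = consistent_signs p [1]"
    using reduce_correct(2)[OF assms _ red] matrix_equation_data_base[of 1 p] by (simp add: base)
  moreover have "find_consistent_signs_at_roots p [] = map tl \<Sigma>"
    using red by (simp add: find_consistent_signs_at_roots_def calc_data.simps[of p "[]"] base del: reduce.simps)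
  ultimately show ?thesis
    by (simp add: consistent_signs_def sign_vector_def image_image)
qed

theorem mainTheorem2:
  fixes p :: "real poly" and qs :: "real poly list"
  assumes "p \<noteq> 0"
    and "\<And>q. q \<in> set qs \<Longrightarrow> coprime q p"
  shows "set (find_consistent_signs_at_roots p qs) =
           {map (\<lambda>q. sgn (poly q x)) qs | x. poly p x = 0}"
proof -
  have "set (find_consistent_signs_at_roots p qs) = consistent_signs p qs"
  proof (cases "qs = []")
    case True
    then show ?thesis using find_consistent_signs_at_roots_Nil[OF assms(1)] by simp
  next
    case False
    obtain M S \<Sigma> where c: "calc_data p qs = (M, S, \<Sigma>)" by (cases "calc_data p qs")
    with calc_data_correct[OF assms(1) False assms(2) c] show ?thesis
      by (simp add: find_consistent_signs_at_roots_def)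
  qed
  also have "\<dots> = {map (\<lambda>q. sgn (poly q x)) qs | x. poly p x = 0}"
    by (auto simp: consistent_signs_def sign_vector_def)
  finally show ?thesis .
qed

end
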